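(* Let $\{V_n\}_{n\ge 0}$ be a generalized Tribonacci sequence with parameters $r,s,t$ and let $\{O_{v,n}\}_{n\ge 0}$ be the associated sequence of generalized Tribonacci octonions. Then the generating function $g(x)=\sum_{n\geq 0}O_{v,n}x^{n}$ is $$g(x)=\frac{O_{v,0}+(O_{v,1}-rO_{v,0})x+(O_{v,2}-rO_{v,1}-sO_{v,0})x^{2}}{1-rx-sx^{2}-tx^{3}}.$$
   Context: Generalized Tribonacci sequence: $r,s,t$ are real numbers, $V_0,V_1,V_2$ are arbitrary integers, and $V_n=rV_{n-1}+sV_{n-2}+tV_{n-3}$ for $n\ge 3$. Standing assumption: $\Delta=\frac{r^{3}t}{27}-\frac{r^{2}s^{2}}{108}+\frac{rst}{6}-\frac{s^{3}}{27}+\frac{t^{2}}{4}>0$, so that $x^3-rx^2-sx-t=0$ has one real root and two nonreal complex conjugate roots. Octonions: $\mathbb{O}$ is the real octonion algebra, an $8$-dimensional real vector space with basis $e_0=\mathbf{1},e_1,\dots,e_7$. The $n$-th generalized Tribonacci octonion is $O_{v,n}=\sum_{l=0}^{7}V_{n+l}e_l=V_n+\sum_{l=1}^{7}V_{n+l}e_l$, $n\ge 0$. The generating function is a formal power series in an indeterminate $x$ with coefficients in $\mathbb{O}$, where $x$ commutes with $\mathbb{O}$; the denominator is a real power series with constant term $1$, hence invertible. *)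

theory Defs
  imports
    Complex_Main
    "HOL-Analysis.Product_Vector"
    "HOL-Computational_Algebra.Formal_Power_Series"
begin

text \<open>
  A quaternion \<open>z + w j\<close> with complex \<open>z\<close>, \<open>w\<close> is the pair \<open>(z, w)\<close>, and an octonion
  \<open>a + b e\<close> with quaternions \<open>a\<close>, \<open>b\<close> is the pair \<open>(a, b)\<close>. Both products are given by the
  Cayley-Dickson rule \<open>(a + b e) (c + d e) = (a c - d* b) + (d a + b c*) e\<close>.
\<close>

type_synonym quat = "complex \<times> complex"

definition qcnj :: "quat \<Rightarrow> quat" where
  "qcnj a = (cnj (fst a), - snd a)"

definition qmult :: "quat \<Rightarrow> quat \<Rightarrow> quat" where
  "qmult a c = (fst a * fst c - cnj (snd c) * snd a, snd c * fst a + snd a * cnj (fst c))"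

typedef octonion = "UNIV :: (quat \<times> quat) set"
  morphisms quat_pair Octonion
  by simp

setup_lifting type_definition_octonion

instantiation octonion :: real_vector
begin

lift_definition zero_octonion :: octonion is 0 .
lift_definition plus_octonion :: "octonion \<Rightarrow> octonion \<Rightarrow> octonion" is "(+)" .
lift_definition minus_octonion :: "octonion \<Rightarrow> octonion \<Rightarrow> octonion" is "(-)" .
lift_definition uminus_octonion :: "octonion \<Rightarrow> octonion" is uminus .
lift_definition scaleR_octonion :: "real \<Rightarrow> octonion \<Rightarrow> octonion" is scaleR .

instance
  by standard (transfer, simp add: algebra_simps)+

end

instantiation octonion :: "{one, times}"
begin

lift_definition one_octonion :: octonion is "((1, 0), (0, 0))" .
lift_definition times_octonion :: "octonion \<Rightarrow> octonion \<Rightarrow> octonion" is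
  "\<lambda>x y. (qmult (fst x) (fst y) - qmult (qcnj (snd y)) (snd x),
          qmult (snd y) (fst x) + qmult (snd x) (qcnj (fst y)))" .

instance ..

end

text \<open>The basis \<open>e\<^sub>0, \<dots>, e\<^sub>7\<close> is \<open>1, i, j, k, e, i e, j e, k e\<close>; indices above 7 are meaningless.\<close>

definition octonion_basis :: "nat \<Rightarrow> octonion" where
  "octonion_basis l = Octonion
     ([((1, 0), (0, 0)), ((\<i>, 0), (0, 0)), ((0, 1), (0, 0)), ((0, \<i>), (0, 0)),
       ((0, 0), (1, 0)), ((0, 0), (\<i>, 0)), ((0, 0), (0, 1)), ((0, 0), (0, \<i>))] ! l)"

lemma octonion_basis_0: "octonion_basis 0 = 1"
  by (simp add: octonion_basis_def one_octonion_def)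

lemma octonion_basis_unique:
  fixes x :: octonion
  shows "\<exists>!c :: nat \<Rightarrow> real. (\<forall>l>7. c l = 0) \<and> x = (\<Sum>l=0..7. c l *\<^sub>R octonion_basis l)"
proof -
  have expand: "(\<Sum>l=0..7. c l *\<^sub>R octonion_basis l) =
      Octonion ((Complex (c 0) (c 1), Complex (c 2) (c 3)),
                (Complex (c 4) (c 5), Complex (c 6) (c 7)))" for c :: "nat \<Rightarrow> real"
    by (simp add: octonion_basis_def eval_nat_numeral scaleR_octonion.abs_eq
        plus_octonion.abs_eq Octonion_inject complex_eq_iff)
  obtain z w u v where x: "x = Octonion ((z, w), (u, v))"
    by (metis prod.exhaust Octonion_cases)
  define c where "c = (\<lambda>l. if l > 7 then 0 else
    [Re z, Im z, Re w, Im w, Re u, Im u, Re v, Im v] ! l)"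
  show ?thesis
  proof (rule ex1I[of _ c])
    show "(\<forall>l>7. c l = 0) \<and> x = (\<Sum>l=0..7. c l *\<^sub>R octonion_basis l)"
      unfolding expand x by (simp add: c_def)
  next
    fix d :: "nat \<Rightarrow> real"
    assume d: "(\<forall>l>7. d l = 0) \<and> x = (\<Sum>l=0..7. d l *\<^sub>R octonion_basis l)"
    then have eqs: "z = Complex (d 0) (d 1)" "w = Complex (d 2) (d 3)"
      "u = Complex (d 4) (d 5)" "v = Complex (d 6) (d 7)"
      unfolding expand x by (simp_all add: Octonion_inject)
    show "d = c"
    proof
      fix l :: nat
      consider "l > 7" | "l = 0" | "l = 1" | "l = 2" | "l = 3" | "l = 4" | "l = 5" | "l = 6" | "l = 7"
        by linarith
      then show "d l = c l"
        using d by cases (simp_all add: c_def eqs)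
    qed
  qed
qed

lemma octonion_mult_laws:
  fixes x y z :: octonion and a :: real
  shows "1 * x = x" and "x * 1 = x"
    and "(x + y) * z = x * z + y * z" and "x * (y + z) = x * y + x * z"
    and "(a *\<^sub>R x) * y = a *\<^sub>R (x * y)" and "x * (a *\<^sub>R y) = a *\<^sub>R (x * y)"
  by (transfer; auto simp: qmult_def qcnj_def algebra_simps prod_eq_iff)+

definition generalized_tribonacci :: "real \<Rightarrow> real \<Rightarrow> real \<Rightarrow> (nat \<Rightarrow> real) \<Rightarrow> bool" where
  "generalized_tribonacci r s t V \<longleftrightarrow>
     V 0 \<in> \<int> \<and> V 1 \<in> \<int> \<and> V 2 \<in> \<int> \<and>
     (\<forall>n\<ge>3. V n = r * V (n - 1) + s * V (n - 2) + t * V (n - 3))"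

definition tribonacci_disc :: "real \<Rightarrow> real \<Rightarrow> real \<Rightarrow> real" where
  "tribonacci_disc r s t =
     r ^ 3 * t / 27 - r ^ 2 * s ^ 2 / 108 + r * s * t / 6 - s ^ 3 / 27 + t ^ 2 / 4"

definition tribonacci_octonion :: "(nat \<Rightarrow> real) \<Rightarrow> nat \<Rightarrow> octonion" where
  "tribonacci_octonion V n = (\<Sum>l=0..7. V (n + l) *\<^sub>R octonion_basis l)"

text \<open>
  Octonions are not associative, so the library has no ring structure on \<^typ>\<open>octonion fps\<close>; the
  Cauchy product is available nevertheless. The embedding below is the one along
  \<open>\<real> \<longrightarrow> \<real> 1\<close>; it sends \<^const>\<open>fps_X\<close> to \<^const>\<open>fps_X\<close>. Its image commutes and associates with
  every octonion power series, so that a quotient \<open>N / D\<close> with real \<open>D\<close> is unambiguous.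
\<close>

definition octonion_fps_of_real :: "real fps \<Rightarrow> octonion fps" where
  "octonion_fps_of_real p = Abs_fps (\<lambda>n. fps_nth p n *\<^sub>R 1)"

definition octonion_fps_divide_real :: "octonion fps \<Rightarrow> real fps \<Rightarrow> octonion fps" where
  "octonion_fps_divide_real N D = N * octonion_fps_of_real (inverse D)"

lemma octonion_fps_of_real_X: "octonion_fps_of_real fps_X = fps_X"
  by (rule fps_ext) (simp add: octonion_fps_of_real_def fps_X_def)

lemma octonion_fps_of_real_commute:
  "octonion_fps_of_real p * g = g * octonion_fps_of_real p"
proof (rule fps_ext)
  fix n
  have "(\<Sum>i=0..n. fps_nth p i *\<^sub>R fps_nth g (n - i)) =
        (\<Sum>i=0..n. fps_nth p (n - i) *\<^sub>R fps_nth g i)"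
    by (rule sum.reindex_bij_witness[of _ "\<lambda>i. n - i" "\<lambda>i. n - i"]) auto
  then show "fps_nth (octonion_fps_of_real p * g) n = fps_nth (g * octonion_fps_of_real p) n"
    by (simp add: fps_mult_nth octonion_fps_of_real_def octonion_mult_laws)
qed

lemma octonion_fps_of_real_assoc:
  "(g * octonion_fps_of_real p) * octonion_fps_of_real q = g * octonion_fps_of_real (p * q)"
proof (rule fps_ext)
  fix n
  have "(\<Sum>i=0..n. fps_nth q (n - i) *\<^sub>R (\<Sum>j=0..i. fps_nth p (i - j) *\<^sub>R fps_nth g j)) =
        (\<Sum>i=0..n. \<Sum>j=0..i. (fps_nth p (i - j) * fps_nth q (n - i)) *\<^sub>R fps_nth g j)"
    by (simp add: scaleR_sum_right mult.commute)
  also have "\<dots> = (\<Sum>j=0..n. \<Sum>i=0..n - j. (fps_nth p i * fps_nth q (n - j - i)) *\<^sub>R fps_nth g j)"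
    unfolding sum.Sigma[OF finite_atLeastAtMost ballI[OF finite_atLeastAtMost]]
    by (rule sum.reindex_bij_witness[of _ "\<lambda>(j, i). (i + j, j)" "\<lambda>(i, j). (j, i - j)"]) auto
  also have "\<dots> = (\<Sum>j=0..n. (\<Sum>i=0..n - j. fps_nth p i * fps_nth q (n - j - i)) *\<^sub>R fps_nth g j)"
    by (simp add: scaleR_sum_left)
  finally show "fps_nth ((g * octonion_fps_of_real p) * octonion_fps_of_real q) n =
      fps_nth (g * octonion_fps_of_real (p * q)) n"
    by (simp add: fps_mult_nth octonion_fps_of_real_def octonion_mult_laws)
qed

lemma octonion_fps_divide_real_cancel:
  assumes "fps_nth D 0 \<noteq> 0"
  shows "octonion_fps_divide_real N D * octonion_fps_of_real D = N"
proof -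
  have "N * octonion_fps_of_real 1 = N"
  proof (rule fps_ext)
    fix n
    have "fps_nth (N * octonion_fps_of_real 1) n = (\<Sum>i=0..n. if i = n then fps_nth N i else 0)"
      unfolding fps_mult_nth
      by (rule sum.cong) (auto simp: octonion_fps_of_real_def octonion_mult_laws)
    then show "fps_nth (N * octonion_fps_of_real 1) n = fps_nth N n"
      by simp
  qed
  then show ?thesis
    using assms by (simp add: octonion_fps_divide_real_def octonion_fps_of_real_assoc inverse_mult_eq_1)
qed

end

theory Submission
  imports Defs
begin

text \<open>
  The sequence of octonions satisfies the recurrence of \<open>V\<close>, because each coordinate is a shift of
  \<open>V\<close> (\<open>tribonacci_octonion_recurrence\<close>). Multiplying the generating function \<open>g\<close> by
  \<open>D = 1 - r x - s x\<^sup>2 - t x\<^sup>3\<close> therefore annihilates every coefficient from \<open>x\<^sup>3\<close> on and leaves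
  the numerator \<open>N\<close>.

  Passing from \<open>g D = N\<close> to \<open>g = N / D\<close> needs \<open>(g D) D\<^sup>-\<^sup>1 = g (D D\<^sup>-\<^sup>1)\<close>. Octonion power series are
  not associative, but this bracketing is harmless since \<open>D\<close> is real
  (\<open>octonion_fps_divide_real_eqI\<close>).
\<close>

lemma fps_nth_mult_octonion_fps_of_real:
  "fps_nth (g * octonion_fps_of_real p) n = (\<Sum>i=0..n. fps_nth p (n - i) *\<^sub>R fps_nth g i)"
  by (simp add: fps_mult_nth octonion_fps_of_real_def octonion_mult_laws)

lemma mult_octonion_fps_of_real_diff:
  "g * octonion_fps_of_real (p - q) = g * octonion_fps_of_real p - g * octonion_fps_of_real q"
  by (rule fps_ext)
    (simp add: fps_nth_mult_octonion_fps_of_real scaleR_left_diff_distrib sum_subtractf)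

lemma fps_nth_mult_octonion_fps_of_real_monom:
  "fps_nth (g * octonion_fps_of_real (fps_const c * fps_X ^ k)) n =
    (if n < k then 0 else c *\<^sub>R fps_nth g (n - k))"
proof -
  have "fps_nth (g * octonion_fps_of_real (fps_const c * fps_X ^ k)) n =
      (\<Sum>i=0..n. if n - i = k then c *\<^sub>R fps_nth g i else 0)"
    unfolding fps_nth_mult_octonion_fps_of_real by (rule sum.cong) auto
  also have "\<dots> = (\<Sum>i=0..n. if i = n - k \<and> k \<le> n then c *\<^sub>R fps_nth g i else 0)"
    by (rule sum.cong) auto
  also have "\<dots> = (if n < k then 0 else c *\<^sub>R fps_nth g (n - k))"
    by (cases "k \<le> n") auto
  finally show ?thesis .
qed

lemma fps_nth_mult_octonion_fps_of_real_X_power: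
  "fps_nth (g * octonion_fps_of_real (fps_X ^ k)) n = (if n < k then 0 else fps_nth g (n - k))"
  using fps_nth_mult_octonion_fps_of_real_monom[of g 1 k n] by simp

lemma mult_octonion_fps_of_real_1: "g * octonion_fps_of_real 1 = g"
  by (rule fps_ext) (use fps_nth_mult_octonion_fps_of_real_X_power[of g 0] in simp)

text \<open>
  Quotients by a real series are characterised by multiplying out: the factors \<open>D\<close> and \<open>D\<^sup>-\<^sup>1\<close> may
  be combined first because real series associate with all octonion series.
\<close>

lemma octonion_fps_divide_real_eqI:
  assumes "fps_nth D 0 \<noteq> 0" and "g * octonion_fps_of_real D = N"
  shows "g = octonion_fps_divide_real N D"
proof -
  have "octonion_fps_divide_real N D = g * octonion_fps_of_real (D * inverse D)"
    by (simp add: octonion_fps_divide_real_def octonion_fps_of_real_assoc flip: assms(2))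
  also have "\<dots> = g"
    using assms(1) by (simp add: inverse_mult_eq_1' mult_octonion_fps_of_real_1)
  finally show ?thesis ..
qed

lemma tribonacci_octonion_recurrence:
  assumes "generalized_tribonacci r s t V" and "n \<ge> 3"
  shows "tribonacci_octonion V n =
    r *\<^sub>R tribonacci_octonion V (n - 1) + s *\<^sub>R tribonacci_octonion V (n - 2)
      + t *\<^sub>R tribonacci_octonion V (n - 3)"
proof -
  have "V (n + l) = r * V (n - 1 + l) + s * V (n - 2 + l) + t * V (n - 3 + l)" for l
  proof -
    have "V (n + l) = r * V (n + l - 1) + s * V (n + l - 2) + t * V (n + l - 3)"
      using assms unfolding generalized_tribonacci_def by (meson trans_le_add1)
    moreover have "n + l - 1 = n - 1 + l" "n + l - 2 = n - 2 + l" "n + l - 3 = n - 3 + l"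
      using assms(2) by simp_all
    ultimately show ?thesis by simp
  qed
  then show ?thesis
    unfolding tribonacci_octonion_def
    by (simp only: scaleR_sum_right scaleR_scaleR scaleR_left_distrib sum.distrib)
qed

theorem theorem3p1:
  fixes r s t :: real and V :: "nat \<Rightarrow> real"
  assumes "tribonacci_disc r s t > 0"
    and "generalized_tribonacci r s t V"
  shows "Abs_fps (\<lambda>n. tribonacci_octonion V n) =
    octonion_fps_divide_real
      (fps_const (tribonacci_octonion V 0)
       + fps_const (tribonacci_octonion V 1 - r *\<^sub>R tribonacci_octonion V 0)
           * octonion_fps_of_real fps_X
       + fps_const (tribonacci_octonion V 2 - r *\<^sub>R tribonacci_octonion V 1
                      - s *\<^sub>R tribonacci_octonion V 0)
           * octonion_fps_of_real (fps_X ^ 2))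
      (1 - fps_const r * fps_X - fps_const s * fps_X ^ 2 - fps_const t * fps_X ^ 3)"
proof (rule octonion_fps_divide_real_eqI)
  let ?O = "tribonacci_octonion V"
  show "fps_nth (1 - fps_const r * fps_X - fps_const s * fps_X ^ 2 - fps_const t * fps_X ^ 3) 0 \<noteq> 0"
    by simp
  show "Abs_fps ?O
      * octonion_fps_of_real (1 - fps_const r * fps_X - fps_const s * fps_X ^ 2 - fps_const t * fps_X ^ 3) =
    fps_const (?O 0)
      + fps_const (?O 1 - r *\<^sub>R ?O 0) * octonion_fps_of_real fps_X
      + fps_const (?O 2 - r *\<^sub>R ?O 1 - s *\<^sub>R ?O 0) * octonion_fps_of_real (fps_X ^ 2)"
    (is "?L = ?R")
  proof (rule fps_ext)
    fix n
    have L: "fps_nth ?L n = ?O n - (if n < 1 then 0 else r *\<^sub>R ?O (n - 1))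
        - (if n < 2 then 0 else s *\<^sub>R ?O (n - 2)) - (if n < 3 then 0 else t *\<^sub>R ?O (n - 3))"
      using fps_nth_mult_octonion_fps_of_real_monom[of "Abs_fps ?O" r 1 n]
      by (simp add: mult_octonion_fps_of_real_diff mult_octonion_fps_of_real_1
          fps_nth_mult_octonion_fps_of_real_monom del: One_nat_def)
    have R: "fps_nth ?R n = (if n = 0 then ?O 0 else 0)
        + (if n = 1 then ?O 1 - r *\<^sub>R ?O 0 else 0)
        + (if n = 2 then ?O 2 - r *\<^sub>R ?O 1 - s *\<^sub>R ?O 0 else 0)"
      using fps_nth_mult_octonion_fps_of_real_X_power[of "fps_const (?O 1 - r *\<^sub>R ?O 0)" 1 n]
      by (auto simp: fps_nth_mult_octonion_fps_of_real_X_power)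
    consider "n = 0" | "n = 1" | "n = 2" | "n \<ge> 3"
      by linarith
    then show "fps_nth ?L n = fps_nth ?R n"
      unfolding L R
      by cases (simp_all add: tribonacci_octonion_recurrence[OF assms(2), of n])
  qed
qed

end
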